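(* Let $V$ be an optimal prefix-free machine, and let $f\colon \{0,1\}^*\to \mathbb{N}$. Suppose that $\#V^{-1}(s)\le f(s)$ for all $s\in\{0,1\}^*$ and that $f$ is right-computable. Then $$\lim_{s\to\infty}\left\{f(s)-\#V^{-1}(s)\right\}=\infty.$$
   Context: $\{0,1\}^*$ is the set of finite binary strings (including the empty string $\lambda$), and $|p|$ is the length of a string $p$. $\mathbb{N}=\{0,1,2,\dots\}$. $\{0,1\}^*$ is ordered as $\lambda,0,1,00,01,10,11,000,\dots$ and identified with $\mathbb{N}$ in this order (that is, $s$ is identified with the natural number $1s-1$, where the concatenation $1s$ is read as a binary integer); the limit $s\to\infty$ is understood via this identification. $\#S$ is the cardinality of a set $S$, and $\operatorname{dom} f$ is the domain of definition of a (partial) function $f$. A subset of $\{0,1\}^*$ is prefix-free if no string in it is a prefix of another string in it. A prefix-free machine is a partial recursive function $C\colon\{0,1\}^*\to\{0,1\}^*$ such that $\operatorname{dom} C$ is a prefix-free set. For a prefix-free machine $C$ and $s\in\{0,1\}^*$, $C^{-1}(s)=\{\,p\in\operatorname{dom} C\mid C(p)=s\,\}$. A prefix-free machine $V$ is optimal if for each prefix-free machine $C$ there exists $d\in\mathbb{N}$ such that for every $p\in\operatorname{dom} C$ there is $q$ with $V(q)=C(p)$ and $|q|\le|p|+d$. A (total) function $f\colon\{0,1\}^*\to\mathbb{N}$ is called right-computable if the set $\{\,(s,n)\in\{0,1\}^*\times\mathbb{N}\mid f(s)\le n\,\}$ is recursively enumerable. *)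

theory Defs
  imports Complex_Main "HOL-Library.Sublist"
begin

datatype recf =
    Zero
  | Succ
  | Proj nat
  | Comp recf "recf list"
  | PrimRec recf recf
  | Mu recf

text \<open>
  \<open>computes r xs y\<close>: the program \<open>r\<close> halts on the argument tuple \<open>xs\<close> with value \<open>y\<close>.
  Programs carry no arity: one program may be applied to tuples of several lengths.  Restricted
  to tuples of any one fixed length, the functions computed are exactly Kleene's partial recursive
  functions of that arity.
\<close>

inductive computes :: "recf \<Rightarrow> nat list \<Rightarrow> nat \<Rightarrow> bool" where
  Zero: "computes Zero xs 0"
| Succ: "computes Succ [x] (Suc x)"
| Proj: "i < length xs \<Longrightarrow> computes (Proj i) xs (xs ! i)"
| Comp: "list_all2 (\<lambda>g y. computes g xs y) gs ys \<Longrightarrow> computes f ys z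
    \<Longrightarrow> computes (Comp f gs) xs z"
| PrimRec_0: "computes f xs y \<Longrightarrow> computes (PrimRec f g) (0 # xs) y"
| PrimRec_Suc: "computes (PrimRec f g) (n # xs) y \<Longrightarrow> computes g (n # y # xs) z
    \<Longrightarrow> computes (PrimRec f g) (Suc n # xs) z"
| Mu: "computes f (n # xs) 0 \<Longrightarrow> (\<And>m. m < n \<Longrightarrow> \<exists>y. computes f (m # xs) (Suc y))
    \<Longrightarrow> computes (Mu f) xs n"

lemma computes_deterministic: "computes r xs y \<Longrightarrow> computes r xs z \<Longrightarrow> y = z"
proof (induction arbitrary: z rule: computes.induct)
  case (Comp xs gs ys f z')
  from Comp.prems obtain ys' where ys': "list_all2 (\<lambda>g y. computes g xs y) gs ys'" "computes f ys' z"
    by (cases rule: computes.cases) auto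
  from Comp.IH(1) ys'(1) have "ys = ys'"
    by (auto simp: list_all2_conv_all_nth intro: nth_equalityI)
  with Comp.IH(2) ys'(2) show ?case by blast
next
  case (Mu f n xs)
  from Mu.prems have z: "computes f (z # xs) 0"
      "\<And>m. m < z \<Longrightarrow> \<exists>y. computes f (m # xs) (Suc y)"
    by (cases rule: computes.cases; simp)+
  have "\<not> n < z" using z(2) Mu.IH(1) by (metis nat.distinct(1))
  moreover have "\<not> z < n" using z(1) Mu.IH(2) by (metis nat.distinct(1))
  ultimately show ?case by simp
next
  case (PrimRec_Suc f g n xs y z z')
  from PrimRec_Suc.prems obtain y' where
    "computes (PrimRec f g) (n # xs) y'" "computes g (n # y' # xs) z'"
    by (cases rule: computes.cases) auto
  with PrimRec_Suc.IH show ?case by blast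
next
  case (PrimRec_0 f xs y g)
  from PrimRec_0.prems have "computes f xs z" by (cases rule: computes.cases) auto
  with PrimRec_0.IH show ?case by blast
next
  case (Zero xs)
  then show ?case by (cases rule: computes.cases) auto
next
  case (Succ x)
  then show ?case by (cases rule: computes.cases) auto
next
  case (Proj i xs)
  from Proj.prems show ?case by (cases rule: computes.cases) auto
qed

text \<open>The string \<open>s\<close> is identified with the number \<open>1s - 1\<close>, where \<open>1s\<close> is read in binary,
  most significant digit first (the head of the list).\<close>

definition str_num :: "bool list \<Rightarrow> nat" where
  "str_num s = foldl (\<lambda>n b. 2 * n + of_bool b) 1 s - 1"

lemma bij_str_num: "bij str_num"
proof -
  let ?F = "foldl (\<lambda>n b. 2 * n + of_bool b) (1::nat)"
  have pos: "?F s \<ge> 1" for s by (induction s rule: rev_induct) auto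
  have inj: "s = t" if "?F s = ?F t" for s t
    using that
  proof (induction s arbitrary: t rule: rev_induct)
    case Nil
    show ?case
    proof (cases t rule: rev_cases)
      case (snoc u b)
      with Nil pos[of u] show ?thesis by simp
    qed simp
  next
    case (snoc a s)
    show ?case
    proof (cases t rule: rev_cases)
      case Nil
      with snoc pos[of s] show ?thesis by simp
    next
      case t: (snoc u b)
      from snoc.prems t have eq: "2 * ?F s + of_bool a = 2 * ?F u + of_bool b" by simp
      have "a = b" using arg_cong[OF eq, of even] by (cases a; cases b; simp)
      with eq snoc.IH[of u] t show ?thesis by simp
    qed
  qed
  have surj: "\<exists>s. ?F s = n" if "n \<ge> 1" for n
    using that
  proof (induction n rule: less_induct)
    case (less n)
    show ?case
    proof (cases "n = 1")
      case True
      then show ?thesis by (intro exI[of _ "[]"]) simp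
    next
      case False
      with less.prems have "n div 2 < n" "n div 2 \<ge> 1" by auto
      from less.IH[OF this] obtain s where "?F s = n div 2" by blast
      then have "?F (s @ [odd n]) = n"
        by simp
      then show ?thesis by blast
    qed
  qed
  show ?thesis
  proof (rule bijI)
    show "inj str_num"
    proof (rule injI)
      fix s t assume "str_num s = str_num t"
      with pos[of s] pos[of t] have "?F s = ?F t" unfolding str_num_def by linarith
      then show "s = t" by (rule inj)
    qed
    show "surj str_num"
    proof (rule surjI)
      fix n
      from someI_ex[OF surj[of "Suc n"]]
      show "str_num (SOME s. ?F s = Suc n) = n" unfolding str_num_def by simp
    qed
  qed
qed

text \<open>The filter of neighbourhoods of infinity along this identification:
  a property holds eventually iff it holds for all \<open>s\<close> with \<open>str_num s\<close> large enough.\<close>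

definition strings_at_top :: "bool list filter" where
  "strings_at_top = filtercomap str_num sequentially"

definition partial_recursive :: "(bool list \<rightharpoonup> bool list) \<Rightarrow> bool" where
  "partial_recursive C \<longleftrightarrow>
    (\<exists>r. \<forall>p s. C p = Some s \<longleftrightarrow> computes r [str_num p] (str_num s))"

definition rec_enumerable :: "(bool list \<times> nat) set \<Rightarrow> bool" where
  "rec_enumerable A \<longleftrightarrow>
    (\<exists>r. \<forall>s n. (s, n) \<in> A \<longleftrightarrow> (\<exists>y. computes r [str_num s, n] y))"

definition right_computable :: "(bool list \<Rightarrow> nat) \<Rightarrow> bool" where
  "right_computable f \<longleftrightarrow> rec_enumerable {(s, n). f s \<le> n}"

definition prefix_free :: "'a list set \<Rightarrow> bool" where
  "prefix_free S \<longleftrightarrow> (\<forall>p\<in>S. \<forall>q\<in>S. \<not> strict_prefix p q)"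

definition prefix_free_machine :: "(bool list \<rightharpoonup> bool list) \<Rightarrow> bool" where
  "prefix_free_machine C \<longleftrightarrow> partial_recursive C \<and> prefix_free (dom C)"

definition optimal_prefix_free_machine :: "(bool list \<rightharpoonup> bool list) \<Rightarrow> bool" where
  "optimal_prefix_free_machine V \<longleftrightarrow> prefix_free_machine V \<and>
    (\<forall>C. prefix_free_machine C \<longrightarrow>
      (\<exists>d. \<forall>p\<in>dom C. \<exists>q. V q = C p \<and> length q \<le> length p + d))"

definition programs :: "(bool list \<rightharpoonup> bool list) \<Rightarrow> bool list \<Rightarrow> bool list set" where
  "programs C s = {p \<in> dom C. C p = Some s}"

end

theory Submission imports Defs begin

text \<open>If the limit were not infinite, there would be a least \<open>L\<close> with
  \<open>f s \<le> #V\<^sup>-\<^sup>1(s) + L\<close> for infinitely many \<open>s\<close>, and then \<open>f s \<ge> #V\<^sup>-\<^sup>1(s) + L\<close> for all but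
  finitely many \<open>s\<close>.  Hence, once some number \<open>c\<close> of programs of such an \<open>s\<close> has been enumerated and
  \<open>f s \<le> L + c\<close> has been verified, the enumeration is known to be complete.  So one can search, given
  \<open>k\<close>, for an \<open>s\<close> all of whose programs are longer than \<open>2k\<close>.  Outputting it on input \<open>0\<^sup>k1\<close> defines a
  prefix-free machine that contradicts the optimality of \<open>V\<close>.\<close>

section \<open>Total recursive functions\<close>

text \<open>The arity \<open>n\<close> is explicit because programs carry none. \<open>F\<close> is
  unconstrained on lists of other lengths, so it may be written freely with \<open>hd\<close>,
  \<open>tl\<close> and \<open>drop\<close>.\<close>

definition rec_fn :: "nat \<Rightarrow> (nat list \<Rightarrow> nat) \<Rightarrow> bool" where
  "rec_fn n F \<longleftrightarrow> (\<exists>r. \<forall>xs. length xs = n \<longrightarrow> computes r xs (F xs))"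

definition rec_tuple :: "nat \<Rightarrow> nat \<Rightarrow> (nat list \<Rightarrow> nat list) \<Rightarrow> bool" where
  "rec_tuple n m A \<longleftrightarrow> (\<forall>xs. length xs = n \<longrightarrow> length (A xs) = m)
    \<and> (\<forall>i<m. rec_fn n (\<lambda>xs. A xs ! i))"

lemma rec_fn_cong:
  assumes "rec_fn n F" "\<And>xs. length xs = n \<Longrightarrow> F xs = G xs"
  shows "rec_fn n G"
  using assms unfolding rec_fn_def by metis

lemma rec_fn_comp:
  assumes F: "rec_fn m F" and A: "rec_tuple n m A"
  shows "rec_fn n (\<lambda>xs. F (A xs))"
proof -
  obtain f where f: "\<And>xs. length xs = m \<Longrightarrow> computes f xs (F xs)"
    using F unfolding rec_fn_def by blast
  have "\<forall>i<m. \<exists>r. \<forall>xs. length xs = n \<longrightarrow> computes r xs (A xs ! i)"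
    using A unfolding rec_tuple_def rec_fn_def by blast
  then obtain g where g: "\<And>i xs. i < m \<Longrightarrow> length xs = n \<Longrightarrow> computes (g i) xs (A xs ! i)"
    by metis
  have "computes (Comp f (map g [0..<m])) xs (F (A xs))" if "length xs = n" for xs
  proof (rule computes.Comp)
    have "length (A xs) = m"
      using A that by (simp add: rec_tuple_def)
    then show "list_all2 (\<lambda>g y. computes g xs y) (map g [0..<m]) (A xs)" "computes f (A xs) (F (A xs))"
      using g that f by (auto simp: list_all2_conv_all_nth)
  qed
  then show ?thesis
    unfolding rec_fn_def by blast
qed

lemma rec_fn_nth: "i < n \<Longrightarrow> rec_fn n (\<lambda>xs. xs ! i)"
  unfolding rec_fn_def using computes.Proj by blast

lemma rec_fn_hd: "0 < n \<Longrightarrow> rec_fn n hd"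
  by (rule rec_fn_cong[OF rec_fn_nth[of 0]]) (auto simp: hd_conv_nth)

lemma rec_tuple_Nil: "rec_tuple n 0 (\<lambda>xs. [])"
  by (simp add: rec_tuple_def)

lemma rec_tuple_Cons:
  "rec_fn n F \<Longrightarrow> rec_tuple n m A \<Longrightarrow> rec_tuple n (Suc m) (\<lambda>xs. F xs # A xs)"
  by (auto simp: rec_tuple_def less_Suc_eq_0_disj)

lemma rec_tuple_drop:
  assumes "n = m + k"
  shows "rec_tuple n m (drop k)"
  unfolding rec_tuple_def
proof (intro conjI allI impI)
  fix i assume "i < m"
  then show "rec_fn n (\<lambda>xs. drop k xs ! i)"
    using assms by (intro rec_fn_cong[OF rec_fn_nth[of "k + i"]]) auto
qed (use assms in auto)

lemma rec_tuple_tl: "rec_tuple (Suc n) n tl"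
  unfolding rec_tuple_def
proof (intro conjI allI impI)
  fix i assume "i < n"
  then show "rec_fn (Suc n) (\<lambda>xs. tl xs ! i)"
    by (intro rec_fn_cong[OF rec_fn_nth[of "Suc i"]]) (auto simp: nth_tl)
qed simp

lemma rec_tuple_comp:
  assumes B: "rec_tuple m k B" and A: "rec_tuple n m A"
  shows "rec_tuple n k (\<lambda>xs. B (A xs))"
  unfolding rec_tuple_def
proof (intro conjI allI impI)
  fix i assume "i < k"
  then have "rec_fn m (\<lambda>xs. B xs ! i)"
    using B by (simp add: rec_tuple_def)
  from rec_fn_comp[OF this A] show "rec_fn n (\<lambda>xs. B (A xs) ! i)" .
qed (use A B in \<open>auto simp: rec_tuple_def\<close>)

lemma rec_tuple_map:
  "(\<And>a. a \<in> set as \<Longrightarrow> rec_fn n (G a)) \<Longrightarrow> rec_tuple n (length as) (\<lambda>xs. map (\<lambda>a. G a xs) as)"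
  by (auto simp: rec_tuple_def)

lemma rec_fn_Suc: "rec_fn n F \<Longrightarrow> rec_fn n (\<lambda>xs. Suc (F xs))"
proof -
  assume F: "rec_fn n F"
  have "computes Succ xs (Suc (hd xs))" if "length xs = 1" for xs
    using that by (cases xs) (auto intro: computes.Succ)
  then have "rec_fn (Suc 0) (\<lambda>xs. Suc (hd xs))"
    unfolding rec_fn_def by auto
  from rec_fn_comp[OF this rec_tuple_Cons[OF F rec_tuple_Nil]] show ?thesis
    by simp
qed

lemma rec_fn_const: "rec_fn n (\<lambda>xs. c)"
proof (induction c)
  case 0
  show ?case
    unfolding rec_fn_def using computes.Zero by blast
qed (rule rec_fn_Suc)

text \<open>Primitive recursion in which the counter is computed as well. \<open>PrimRec\<close>
  hands its step program the counter, the previous value and the parameters in this order;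
  \<open>hd ys\<close>, \<open>hd (tl ys)\<close> and \<open>drop 2 ys\<close> read them
  off.\<close>

lemma rec_fn_rec:
  assumes F: "rec_fn n F"
    and G: "rec_fn (Suc (Suc n)) (\<lambda>ys. G (hd ys) (hd (tl ys)) (drop 2 ys))"
    and K: "rec_fn n K"
  shows "rec_fn n (\<lambda>xs. rec_nat (F xs) (\<lambda>k y. G k y xs) (K xs))"
proof -
  obtain f where f: "\<And>xs. length xs = n \<Longrightarrow> computes f xs (F xs)"
    using F unfolding rec_fn_def by blast
  obtain g where g: "\<And>ys. length ys = Suc (Suc n)
      \<Longrightarrow> computes g ys (G (hd ys) (hd (tl ys)) (drop 2 ys))"
    using G unfolding rec_fn_def by blast
  have "computes (PrimRec f g) (k # xs) (rec_nat (F xs) (\<lambda>k y. G k y xs) k)"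
    if "length xs = n" for k xs
  proof (induction k)
    case (Suc k)
    from computes.PrimRec_Suc[OF this] g[of "k # _ # xs"] that show ?case
      by simp
  qed (use f that in \<open>auto intro: computes.PrimRec_0\<close>)
  then have "computes (PrimRec f g) ys (rec_nat (F (tl ys)) (\<lambda>k y. G k y (tl ys)) (hd ys))"
    if "length ys = Suc n" for ys
    using that by (cases ys) auto
  then have "rec_fn (Suc n) (\<lambda>ys. rec_nat (F (tl ys)) (\<lambda>k y. G k y (tl ys)) (hd ys))"
    unfolding rec_fn_def by blast
  moreover have "rec_tuple n (Suc n) (\<lambda>xs. K xs # drop 0 xs)"
    by (intro rec_tuple_Cons K rec_tuple_drop) simp
  ultimately show ?thesis
    using rec_fn_comp by fastforce
qed

lemma rec_fn_drop: "rec_fn n F \<Longrightarrow> m = n + k \<Longrightarrow> rec_fn m (\<lambda>ys. F (drop k ys))"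
  by (rule rec_fn_comp[OF _ rec_tuple_drop])

lemma rec_fn_hd_tl: "rec_fn (Suc (Suc n)) (\<lambda>ys. hd (tl ys))"
  by (rule rec_fn_comp[OF rec_fn_hd rec_tuple_tl]) simp

lemma rec_fn_add:
  assumes "rec_fn n F" "rec_fn n G"
  shows "rec_fn n (\<lambda>xs. F xs + G xs)"
proof -
  have "rec_nat a (\<lambda>_. Suc) b = a + b" for a b :: nat
    by (induction b) auto
  moreover have "rec_fn n (\<lambda>xs. rec_nat (F xs) (\<lambda>_ y. Suc y) (G xs))"
    by (intro rec_fn_rec assms rec_fn_Suc rec_fn_hd_tl)
  ultimately show ?thesis by simp
qed

lemma rec_fn_mult:
  assumes "rec_fn n F" "rec_fn n G"
  shows "rec_fn n (\<lambda>xs. F xs * G xs)"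
proof -
  have "rec_nat 0 (\<lambda>_ y. y + a) b = a * b" for a b :: nat
    by (induction b) auto
  moreover have "rec_fn n (\<lambda>xs. rec_nat 0 (\<lambda>_ y. y + F xs) (G xs))"
    by (intro rec_fn_rec[where G = "\<lambda>_ y xs. y + F xs"] assms rec_fn_const rec_fn_add rec_fn_hd_tl
        rec_fn_drop[OF assms(1)]) auto
  ultimately show ?thesis by simp
qed

lemma rec_fn_diff:
  assumes "rec_fn n F" "rec_fn n G"
  shows "rec_fn n (\<lambda>xs. F xs - G xs)"
proof -
  \<comment> \<open>The predecessor is a recursion that returns its counter and ignores the previous
    value. Iterating it gives truncated subtraction, from which the comparisons are built.\<close>
  have pred: "rec_nat 0 (\<lambda>k _. k) a = a - 1" for a :: nat
    by (cases a) auto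
  have "rec_fn m (\<lambda>xs. rec_nat 0 (\<lambda>k _. k) (H xs))" if "rec_fn m H" for m H
    by (intro rec_fn_rec[where G = "\<lambda>k _ _. k"] that rec_fn_const rec_fn_hd) auto
  then have "rec_fn n (\<lambda>xs. rec_nat (F xs) (\<lambda>_ y. y - 1) (G xs))"
    by (intro rec_fn_rec[where G = "\<lambda>_ y _. y - 1"] assms) (auto simp: pred rec_fn_hd_tl)
  moreover have "rec_nat a (\<lambda>_ y. y - 1) b = a - b" for a b :: nat
    by (induction b) auto
  ultimately show ?thesis by simp
qed

lemma rec_fn_le:
  assumes "rec_fn n F" "rec_fn n G"
  shows "rec_fn n (\<lambda>xs. of_bool (F xs \<le> G xs))"
  by (rule rec_fn_cong[of _ "\<lambda>xs. 1 - (F xs - G xs)"])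
    ((intro rec_fn_diff rec_fn_const assms), auto)

lemma rec_fn_eq:
  assumes "rec_fn n F" "rec_fn n G"
  shows "rec_fn n (\<lambda>xs. of_bool (F xs = G xs))"
  by (rule rec_fn_cong[OF rec_fn_mult[OF rec_fn_le[OF assms] rec_fn_le[OF assms(2,1)]]]) auto

lemma rec_fn_if:
  assumes "rec_fn n (\<lambda>xs. of_bool (P xs))" "rec_fn n F" "rec_fn n G"
  shows "rec_fn n (\<lambda>xs. if P xs then F xs else G xs)"
  by (rule rec_fn_cong[of _ "\<lambda>xs. of_bool (P xs) * F xs + (1 - of_bool (P xs)) * G xs"])
    ((intro rec_fn_add rec_fn_mult rec_fn_diff rec_fn_const assms), auto)

text \<open>Bounded sums serve below for counting and, being positive iff some summand is, as
  bounded existential quantifiers.\<close>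

lemma rec_fn_sum:
  assumes G: "rec_fn (Suc n) (\<lambda>ys. G (hd ys) (tl ys))" and K: "rec_fn n K"
  shows "rec_fn n (\<lambda>xs. \<Sum>i<K xs. G i xs)"
proof -
  have "rec_tuple (Suc (Suc n)) (Suc n) (\<lambda>ys. hd ys # drop 2 ys)"
    by (intro rec_tuple_Cons rec_tuple_drop rec_fn_hd) auto
  from rec_fn_comp[OF G this]
  have "rec_fn n (\<lambda>xs. rec_nat 0 (\<lambda>i y. y + G i xs) (K xs))"
    by (intro rec_fn_rec[where G = "\<lambda>i y xs. y + G i xs"] K rec_fn_const rec_fn_add rec_fn_hd_tl) simp
  moreover have "rec_nat 0 (\<lambda>i y. y + G i xs) k = (\<Sum>i<k. G i xs)" for k xs
    by (induction k) auto
  ultimately show ?thesis by simp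
qed

lemma rec_fn_power:
  assumes "rec_fn n F"
  shows "rec_fn n (\<lambda>xs. c ^ F xs)"
proof -
  have "rec_nat 1 (\<lambda>_ y. c * y) b = c ^ b" for b :: nat
    by (induction b) auto
  moreover have "rec_fn n (\<lambda>xs. rec_nat 1 (\<lambda>_ y. c * y) (F xs))"
    by (intro rec_fn_rec[where G = "\<lambda>_ y _. c * y"] assms rec_fn_const rec_fn_mult rec_fn_hd_tl)
  ultimately show ?thesis by simp
qed

section \<open>Evaluation with bounded fuel\<close>

text \<open>\<open>ev r t xs\<close> is \<open>Suc y\<close> if \<open>r\<close> is seen to halt on \<open>xs\<close> with value \<open>y\<close> when every unbounded
  search is cut off after \<open>t\<close> steps, and \<open>0\<close> otherwise.\<close>

fun ev :: "recf \<Rightarrow> nat \<Rightarrow> nat list \<Rightarrow> nat" where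
  "ev Zero t xs = 1"
| "ev Succ t xs = (if length xs = 1 then Suc (Suc (hd xs)) else 0)"
| "ev (Proj i) t xs = (if i < length xs then Suc (xs ! i) else 0)"
| "ev (Comp f gs) t xs =
    (if (\<Prod>g\<leftarrow>gs. ev g t xs) = 0 then 0 else ev f t (map (\<lambda>g. ev g t xs - 1) gs))"
| "ev (PrimRec f g) t xs = (if xs = [] then 0 else
    rec_nat (ev f t (tl xs)) (\<lambda>k v. if v = 0 then 0 else ev g t (k # (v - 1) # tl xs)) (hd xs))"
| "ev (Mu f) t xs =
    (let m = rec_nat 0 (\<lambda>_ m. if 2 \<le> ev f t (m # xs) then Suc m else m) t
     in if ev f t (m # xs) = 1 then Suc m else 0)"

lemma ev_sound: "ev r t xs = Suc y \<Longrightarrow> computes r xs y"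
proof (induction r arbitrary: xs y)
  case (Comp f gs)
  \<comment> \<open>The product in \<open>ev\<close> vanishes as soon as one component is not seen
    to halt, so a positive result accounts for all of them.\<close>
  have nz: "ev g t xs \<noteq> 0" if "g \<in> set gs" for g
    using Comp.prems that by (auto simp: prod_list_zero_iff split: if_splits)
  show ?case
  proof (rule computes.Comp)
    show "list_all2 (\<lambda>g y. computes g xs y) gs (map (\<lambda>g. ev g t xs - 1) gs)"
      using nz Comp.IH(2) by (auto simp: list_all2_conv_all_nth)
    show "computes f (map (\<lambda>g. ev g t xs - 1) gs) y"
      using Comp.prems by (intro Comp.IH(1)) (auto split: if_splits)
  qed
next
  case (PrimRec f g)
  obtain n zs where xs: "xs = n # zs"
    using PrimRec.prems by (cases xs) auto
  have "computes (PrimRec f g) (n # zs) y"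
    if "rec_nat (ev f t zs) (\<lambda>k v. if v = 0 then 0 else ev g t (k # (v - 1) # zs)) n = Suc y"
    using that
  proof (induction n arbitrary: y)
    case 0
    then show ?case by (auto intro: computes.PrimRec_0 PrimRec.IH)
  next
    case (Suc n)
    let ?v = "rec_nat (ev f t zs) (\<lambda>k v. if v = 0 then 0 else ev g t (k # (v - 1) # zs)) n"
    obtain v where v: "?v = Suc v"
      using Suc.prems by (cases ?v) auto
    then have "ev g t (n # v # zs) = Suc y"
      using Suc.prems by auto
    then show ?case
      using Suc.IH[OF v] PrimRec.IH(2) by (auto intro: computes.PrimRec_Suc)
  qed
  then show ?case
    using PrimRec.prems xs by (simp cong: if_cong)
next
  case (Mu f)
  let ?m = "rec_nat 0 (\<lambda>_ m. if 2 \<le> ev f t (m # xs) then Suc m else m)"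
  \<comment> \<open>The loop advances only past arguments whose encoded value is at least
    \<open>2\<close>, that is, whose value is seen to be positive. This is the side condition of the
    rule \<open>Mu\<close>.\<close>
  have below: "2 \<le> ev f t (i # xs)" if "i < ?m k" for i k
    using that by (induction k) (auto simp: less_Suc_eq split: if_splits)
  have y: "y = ?m t" and 0: "ev f t (y # xs) = 1"
    using Mu.prems by (auto simp: Let_def split: if_splits)
  show ?case
  proof (rule computes.Mu)
    show "computes f (y # xs) 0"
      using 0 by (intro Mu.IH) simp
    fix i assume "i < y"
    with below[of i t] y have "ev f t (i # xs) = Suc (Suc (ev f t (i # xs) - 2))"
      by simp
    then show "\<exists>z. computes f (i # xs) (Suc z)"
      using Mu.IH by blast
  qed
next
  case Succ
  then show ?case
    by (cases xs) (auto intro: computes.Succ split: if_splits)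
qed (auto intro: computes.intros split: if_splits)

text \<open>A halting computation rests on finitely many subcomputations. Each of them is evaluated
  correctly for all large \<open>t\<close>, and finitely many such conditions hold together for all
  large \<open>t\<close>.\<close>

lemma ev_complete: "computes r xs y \<Longrightarrow> eventually (\<lambda>t. ev r t xs = Suc y) sequentially"
proof (induction rule: computes.induct)
  case (Comp xs gs ys f z)
  have len: "length gs = length ys"
    using Comp.IH(1) by (rule list_all2_lengthD)
  have "eventually (\<lambda>t. \<forall>i\<in>{..<length gs}. ev (gs ! i) t xs = Suc (ys ! i)) sequentially"
    using Comp.IH(1) by (intro eventually_ball_finite) (auto simp: list_all2_conv_all_nth)
  with Comp.IH(2) show ?case
  proof eventually_elim
    case (elim t)
    have "map (\<lambda>g. ev g t xs - 1) gs = ys"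
      using elim(2) len by (intro nth_equalityI) auto
    moreover have "\<forall>g\<in>set gs. ev g t xs \<noteq> 0"
      using elim(2) by (metis in_set_conv_nth lessThan_iff nat.distinct(1))
    then have "(\<Prod>g\<leftarrow>gs. ev g t xs) \<noteq> 0"
      by (auto simp: prod_list_zero_iff)
    ultimately show ?case
      using elim(1) by simp
  qed
next
  case (PrimRec_Suc f g n xs y z)
  from PrimRec_Suc.IH show ?case
    by eventually_elim (simp cong: if_cong)
next
  case (Mu f n xs)
  have "\<forall>m\<in>{..<n}. eventually (\<lambda>t. 2 \<le> ev f t (m # xs)) sequentially"
  proof
    fix m assume "m \<in> {..<n}"
    then obtain y where "eventually (\<lambda>t. ev f t (m # xs) = Suc (Suc y)) sequentially"
      using Mu.IH(2) by auto
    then show "eventually (\<lambda>t. 2 \<le> ev f t (m # xs)) sequentially"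
      by eventually_elim simp
  qed
  then have "eventually (\<lambda>t. \<forall>m\<in>{..<n}. 2 \<le> ev f t (m # xs)) sequentially"
    by (intro eventually_ball_finite) auto
  with Mu.IH(1) eventually_ge_at_top[of n] show ?case
  proof eventually_elim
    case (elim t)
    \<comment> \<open>The counter rises by one per round until it reaches \<open>n\<close>, where
      the encoded value \<open>1\<close> stops it; \<open>t \<ge> n\<close> rounds suffice.\<close>
    have "rec_nat 0 (\<lambda>_ m. if 2 \<le> ev f t (m # xs) then Suc m else m) k = min k n" for k
    proof (induction k)
      case (Suc k)
      show ?case
        by (cases "k < n") (use elim Suc in auto)
    qed simp
    from this[of t] have "rec_nat 0 (\<lambda>_ m. if 2 \<le> ev f t (m # xs) then Suc m else m) t = n"
      using elim(2) by simp
    then show ?case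
      using elim(1) by simp
  qed
qed (auto intro: always_eventually)

text \<open>Induction on the fixed program \<open>r\<close> assembles the evaluator from the closure
  properties. The arity is generalised because subprograms take other numbers of arguments; since it
  is fixed in each case, tests on \<open>length xs\<close> are decided outside the program.\<close>

lemma rec_fn_ev: "rec_fn (Suc n) (\<lambda>ys. ev r (hd ys) (tl ys))"
proof (induction r arbitrary: n)
  case Zero
  show ?case by (simp add: rec_fn_const)
next
  case Succ
  show ?case
  proof (cases "n = 1")
    case True
    have "rec_fn (Suc n) (\<lambda>ys. Suc (Suc (hd (tl ys))))"
      using True rec_fn_hd_tl[of 0] by (auto intro: rec_fn_Suc)
    then show ?thesis
      by (rule rec_fn_cong) (simp add: True)
  next
    case False
    show ?thesis
      by (rule rec_fn_cong[OF rec_fn_const[of _ 0]]) (use False in simp)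
  qed
next
  case (Proj i)
  show ?case
  proof (cases "i < n")
    case True
    then have "rec_fn (Suc n) (\<lambda>ys. Suc (ys ! Suc i))"
      by (intro rec_fn_Suc rec_fn_nth) simp
    then show ?thesis
      by (rule rec_fn_cong) (simp add: True nth_tl)
  next
    case False
    show ?thesis
      by (rule rec_fn_cong[OF rec_fn_const[of _ 0]]) (simp add: False)
  qed
next
  case (Comp f gs)
  \<comment> \<open>Stated for lists \<open>hs\<close> of members of \<open>gs\<close>, so that an
    induction on \<open>hs\<close> can still use the hypothesis about the subprograms in
    \<open>gs\<close>.\<close>
  have prod: "rec_fn (Suc n) (\<lambda>ys. \<Prod>g\<leftarrow>hs. ev g (hd ys) (tl ys))"
    if "set hs \<subseteq> set gs" for hs
    using that by (induction hs) (auto intro: rec_fn_const rec_fn_mult Comp.IH(2))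
  have args: "rec_tuple (Suc n) (length gs)
      (\<lambda>ys. map (\<lambda>g. ev g (hd ys) (tl ys) - 1) gs)"
    by (intro rec_tuple_map rec_fn_diff rec_fn_const Comp.IH(2))
  have "rec_fn (Suc n) (\<lambda>ys. ev f (hd ys) (map (\<lambda>g. ev g (hd ys) (tl ys) - 1) gs))"
    using rec_fn_comp[OF Comp.IH(1) rec_tuple_Cons[OF rec_fn_hd[of "Suc n"] args]] by simp
  then show ?case
    by (simp, intro rec_fn_if rec_fn_eq prod rec_fn_const) auto
next
  case (PrimRec f g)
  show ?case
  proof (cases n)
    case 0
    show ?thesis
      by (rule rec_fn_cong[OF rec_fn_const[of _ 0]]) (auto simp: 0 length_Suc_conv)
  next
    case (Suc m)
    \<comment> \<open>In \<open>zs\<close> stand the counter, the encoded previous value, the fuel,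
      the recursion argument and the parameters. \<open>?A\<close> rearranges them into the input of
      the evaluator of \<open>g\<close>: fuel, counter, decoded value, parameters.\<close>
    let ?A = "\<lambda>zs. hd (drop 2 zs) # hd zs # (hd (tl zs) - 1) # tl (tl (drop 2 zs))"
    have "rec_tuple (Suc (Suc (Suc n))) (Suc (Suc (Suc m))) ?A"
      unfolding Suc
      by (intro rec_tuple_Cons rec_fn_hd rec_fn_diff rec_fn_const rec_fn_hd_tl rec_fn_drop[OF rec_fn_hd]
          rec_tuple_comp[OF rec_tuple_tl rec_tuple_comp[OF rec_tuple_tl rec_tuple_drop]]) auto
    from rec_fn_comp[OF PrimRec.IH(2) this]
    have step: "rec_fn (Suc (Suc (Suc n))) (\<lambda>zs. if hd (tl zs) = 0 then 0
        else ev g (hd (drop 2 zs)) (hd zs # (hd (tl zs) - 1) # tl (tl (drop 2 zs))))"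
      unfolding list.sel by (intro rec_fn_if rec_fn_eq rec_fn_const rec_fn_hd_tl)
    have "rec_tuple (Suc n) (Suc m) (\<lambda>ys. hd ys # tl (drop 1 ys))"
      unfolding Suc
      by (intro rec_tuple_Cons rec_fn_hd rec_tuple_comp[OF rec_tuple_tl rec_tuple_drop]) auto
    from rec_fn_comp[OF PrimRec.IH(1) this]
    have base: "rec_fn (Suc n) (\<lambda>ys. ev f (hd ys) (tl (tl ys)))"
      by (simp add: drop_Suc)
    have "rec_fn (Suc n) (\<lambda>ys. rec_nat (ev f (hd ys) (tl (tl ys)))
        (\<lambda>k v. if v = 0 then 0 else ev g (hd ys) (k # (v - 1) # tl (tl ys))) (hd (tl ys)))"
      using Suc
      by (intro rec_fn_rec[where G = "\<lambda>k v ys. if v = 0 then 0 else ev g (hd ys) (k # (v - 1) # tl (tl ys))"]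
          base step) (auto intro: rec_fn_hd_tl)
    then show ?thesis
      by (rule rec_fn_cong) (use Suc in \<open>auto simp: length_Suc_conv\<close>)
  qed
next
  case (Mu f)
  let ?M = "\<lambda>ys. rec_nat 0 (\<lambda>_ m. if 2 \<le> ev f (hd ys) (m # tl ys) then Suc m else m) (hd ys)"
  have "rec_tuple (Suc (Suc (Suc n))) (Suc (Suc n))
      (\<lambda>zs. hd (drop 2 zs) # hd (tl zs) # tl (drop 2 zs))"
    by (intro rec_tuple_Cons rec_fn_hd_tl rec_fn_drop[OF rec_fn_hd] rec_tuple_comp[OF rec_tuple_tl rec_tuple_drop]) auto
  from rec_fn_comp[OF Mu.IH this]
  have step: "rec_fn (Suc (Suc (Suc n))) (\<lambda>zs.
      if 2 \<le> ev f (hd (drop 2 zs)) (hd (tl zs) # tl (drop 2 zs)) then Suc (hd (tl zs)) else hd (tl zs))"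
    by (intro rec_fn_if rec_fn_le rec_fn_const rec_fn_Suc rec_fn_hd_tl) simp
  have M: "rec_fn (Suc n) ?M"
    by (intro rec_fn_rec[where G = "\<lambda>_ m ys. if 2 \<le> ev f (hd ys) (m # tl ys) then Suc m else m"]
        step rec_fn_hd rec_fn_const) auto
  have "rec_tuple (Suc n) (Suc (Suc n)) (\<lambda>ys. hd ys # ?M ys # tl ys)"
    by (intro rec_tuple_Cons M rec_fn_hd rec_tuple_tl) auto
  from rec_fn_comp[OF Mu.IH this]
  have "rec_fn (Suc n) (\<lambda>ys. if ev f (hd ys) (?M ys # tl ys) = 1 then Suc (?M ys) else 0)"
    by (intro rec_fn_if rec_fn_eq rec_fn_const rec_fn_Suc M) simp
  then show ?case
    by (simp add: Let_def)
qed

lemma rec_fn_ev_comp: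
  assumes "rec_fn n T" "rec_tuple n m A"
  shows "rec_fn n (\<lambda>xs. ev r (T xs) (A xs))"
  using rec_fn_comp[OF rec_fn_ev rec_tuple_Cons[OF assms]] by simp

section \<open>Unbounded search\<close>

text \<open>For a total \<open>r\<close>, determinism turns every halting claim into an equation
  about \<open>F\<close>.\<close>

lemma computes_Mu_iff:
  assumes "\<And>ys. length ys = Suc (length xs) \<Longrightarrow> computes r ys (F ys)"
  shows "computes (Mu r) xs n \<longleftrightarrow> F (n # xs) = 0 \<and> (\<forall>m<n. F (m # xs) \<noteq> 0)"
proof -
  have iff: "computes r (m # xs) y \<longleftrightarrow> F (m # xs) = y" for m y
    using assms[of "m # xs"] computes_deterministic by auto
  show ?thesis
  proof
    assume "computes (Mu r) xs n"
    then have "computes r (n # xs) 0" "\<And>m. m < n \<Longrightarrow> \<exists>y. computes r (m # xs) (Suc y)"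
      by (cases rule: computes.cases; simp)+
    then show "F (n # xs) = 0 \<and> (\<forall>m<n. F (m # xs) \<noteq> 0)"
      unfolding iff by fastforce
  next
    assume "F (n # xs) = 0 \<and> (\<forall>m<n. F (m # xs) \<noteq> 0)"
    then have "F (n # xs) = 0" "\<And>m. m < n \<Longrightarrow> \<exists>y. F (m # xs) = Suc y"
      using not0_implies_Suc by auto
    then show "computes (Mu r) xs n"
      by (intro computes.Mu) (simp_all add: iff)
  qed
qed

text \<open>A first search finds a bound \<open>t\<close> below which a witness \<open>s\<close> exists, and a second one finds
  the least \<open>s\<close> for this \<open>t\<close>; this avoids coding the pair \<open>(s, t)\<close> by a number.\<close>

lemma ex_recf_choice:
  assumes P: "rec_fn 3 (\<lambda>ys. P (ys ! 0) (ys ! 1) (ys ! 2))"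
  obtains r where "\<And>x s. computes r [x] s \<Longrightarrow> \<exists>t. P s t x \<noteq> 0"
    and "\<And>x s. eventually (\<lambda>t. P s t x \<noteq> 0) sequentially \<Longrightarrow> \<exists>s. computes r [x] s"
proof -
  have "rec_fn 3 (\<lambda>ys. 1 - P (ys ! 0) (ys ! 1) (ys ! 2))"
    by (intro rec_fn_diff rec_fn_const P)
  then obtain b where b: "\<And>ys. length ys = 3 \<Longrightarrow> computes b ys (1 - P (ys ! 0) (ys ! 1) (ys ! 2))"
    unfolding rec_fn_def by blast
  have "rec_fn 3 (\<lambda>ys. P (hd ys) (tl ys ! 0) (tl ys ! 1))"
    by (rule rec_fn_cong[OF P]) (auto simp: length_Suc_conv numeral_3_eq_3 numeral_2_eq_2)
  then have "rec_fn (Suc 2) (\<lambda>ys. P (hd ys) (tl ys ! 0) (tl ys ! 1))"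
    by simp
  \<comment> \<open>\<open>Mu\<close> looks for zeros, and this expression vanishes iff some
    \<open>s\<close> below the bound \<open>ys ! 0\<close> passes the test with that bound as
    \<open>t\<close>.\<close>
  then have "rec_fn 2 (\<lambda>ys. 1 - (\<Sum>s<ys ! 0. P s (ys ! 0) (ys ! 1)))"
    by (intro rec_fn_diff rec_fn_const rec_fn_sum[where G = "\<lambda>s ys. P s (ys ! 0) (ys ! 1)"] rec_fn_nth) auto
  then obtain a where a: "\<And>ys. length ys = 2
      \<Longrightarrow> computes a ys (1 - (\<Sum>s<ys ! 0. P s (ys ! 0) (ys ! 1)))"
    unfolding rec_fn_def by blast
  have mua: "computes (Mu a) [x] t \<longleftrightarrow> 1 - (\<Sum>s<t. P s t x) = 0 \<and> (\<forall>u<t. 1 - (\<Sum>s<u. P s u x) \<noteq> 0)" for t x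
    by (subst computes_Mu_iff[OF a]) auto
  have mub: "computes (Mu b) [t, x] s \<longleftrightarrow> 1 - P s t x = 0 \<and> (\<forall>u<s. 1 - P u t x \<noteq> 0)" for s t x
    by (subst computes_Mu_iff[OF b]) (auto simp: numeral_2_eq_2)
  let ?r = "Comp (Mu b) [Mu a, Proj 0]"
  show thesis
  proof (rule that[of ?r])
    fix x s assume "computes ?r [x] s"
    then obtain t x' where "computes (Mu b) [t, x'] s" "computes (Proj 0) [x] x'"
      by (cases rule: computes.cases) (auto simp: list_all2_Cons1)
    moreover from this(2) have "x' = x"
      by (cases rule: computes.cases) auto
    ultimately show "\<exists>t. P s t x \<noteq> 0"
      using mub by (metis diff_zero zero_neq_one)
  next
    fix x s assume "eventually (\<lambda>t. P s t x \<noteq> 0) sequentially"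
    \<comment> \<open>Success for all large \<open>t\<close> allows a \<open>t\<close> above
      \<open>s\<close>, as the first search requires.\<close>
    with eventually_gt_at_top[of s] have "eventually (\<lambda>t. s < t \<and> P s t x \<noteq> 0) sequentially"
      by eventually_elim simp
    then obtain t where t: "s < t" "P s t x \<noteq> 0"
      using eventually_happens by force
    have "P s t x \<le> (\<Sum>s<t. P s t x)"
      using t(1) by (intro member_le_sum) auto
    then have ex: "1 - (\<Sum>s<t. P s t x) = 0"
      using t(2) by simp
    define T where "T = (LEAST t. 1 - (\<Sum>s<t. P s t x) = 0)"
    have T: "1 - (\<Sum>s<T. P s T x) = 0" "computes (Mu a) [x] T"
      unfolding mua T_def using LeastI[of "\<lambda>t. 1 - (\<Sum>s<t. P s t x) = 0", OF ex] not_less_Least by blast+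
    \<comment> \<open>The bound \<open>T\<close> may be smaller than \<open>t\<close> and its
      witness \<open>u\<close> may differ from \<open>s\<close>; any number passing the test is an
      admissible output.\<close>
    then obtain u where "1 - P u T x = 0"
      by (metis (no_types, lifting) diff_zero gr_zeroI sum.neutral zero_neq_one less_one not_less diff_is_0_eq)
    then have "computes (Mu b) [T, x] (LEAST u. 1 - P u T x = 0)"
      unfolding mub using LeastI[of "\<lambda>u. 1 - P u T x = 0"] not_less_Least by blast
    then have "computes ?r [x] (LEAST u. 1 - P u T x = 0)"
      using T(2) computes.Proj[of 0 "[x]"] by (intro computes.Comp[where ys = "[T, x]"]) auto
    then show "\<exists>s. computes ?r [x] s" ..
  qed
qed

section \<open>The numbering of strings\<close>

text \<open>\<open>Suc (str_num p)\<close> has the binary digits \<open>1p\<close>, hence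
  \<open>Suc (length p)\<close> of them. The bound turns a large program number into a large program
  length.\<close>

lemma str_num_less: "Suc (str_num p) < 2 ^ Suc (length p)"
proof -
  have "foldl (\<lambda>n b. 2 * n + of_bool b) (1::nat) p < 2 ^ Suc (length p)
      \<and> foldl (\<lambda>n b. 2 * n + of_bool b) (1::nat) p \<ge> 1"
    by (induction p rule: rev_induct) auto
  then show ?thesis
    by (auto simp: str_num_def)
qed

text \<open>The binary digits \<open>1\<close>, \<open>k\<close> zeros, \<open>1\<close> denote
  \<open>2 ^ Suc k + 1\<close>. Subtracting \<open>1\<close> leaves a power of two, so these inputs
  are recognisable by arithmetic.\<close>

lemma str_num_unary: "str_num (replicate k False @ [True]) = 2 ^ Suc k"
proof -
  have "foldl (\<lambda>n b. 2 * n + of_bool b) (m::nat) (replicate k False) = m * 2 ^ k" for m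
    by (induction k arbitrary: m) auto
  then show ?thesis
    by (simp add: str_num_def)
qed

text \<open>The first \<open>True\<close> marks the end of the string.\<close>

lemma prefix_free_unary: "prefix_free (range (\<lambda>k. replicate k False @ [True]))"
proof -
  have "j = k" if "replicate k False @ True # zs = replicate j False @ [True]" for j k :: nat and zs
    using that
  proof (induction k arbitrary: j)
    case 0
    then show ?case by (cases j) auto
  next
    case (Suc k)
    then show ?case by (cases j) auto
  qed
  then show ?thesis
    by (auto simp: prefix_free_def strict_prefix_def prefix_def)
qed

lemma eventually_strings_at_top:
  "eventually Q strings_at_top \<longleftrightarrow> (\<exists>N. \<forall>s. N \<le> str_num s \<longrightarrow> Q s)"
proof
  assume "eventually Q strings_at_top"
  then show "\<exists>N. \<forall>s. N \<le> str_num s \<longrightarrow> Q s"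
    unfolding strings_at_top_def eventually_filtercomap eventually_sequentially by blast
next
  assume "\<exists>N. \<forall>s. N \<le> str_num s \<longrightarrow> Q s"
  then obtain N where "\<forall>s. N \<le> str_num s \<longrightarrow> Q s" ..
  then show "eventually Q strings_at_top"
    unfolding strings_at_top_def eventually_filtercomap
    by (intro exI[of _ "\<lambda>n. N \<le> n"]) (auto simp: eventually_ge_at_top)
qed

section \<open>The limit\<close>

theorem theorem7:
  fixes V :: "bool list \<rightharpoonup> bool list" and f :: "bool list \<Rightarrow> nat"
  assumes "optimal_prefix_free_machine V"
    and "\<And>s. finite (programs V s) \<and> card (programs V s) \<le> f s"
    and "right_computable f"
  shows "filterlim (\<lambda>s. int (f s) - int (card (programs V s))) at_top strings_at_top"
proof (rule ccontr)

  \<comment> \<open>The least excess attained infinitely often\<close>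
  let ?c = "\<lambda>s. card (programs V s)"
  let ?often = "\<lambda>L. \<forall>N. \<exists>s. N \<le> str_num s \<and> f s \<le> ?c s + L"
  assume "\<not> ?thesis"
  then obtain Z where Z: "\<And>N. \<exists>s. N \<le> str_num s \<and> \<not> Z \<le> int (f s) - int (?c s)"
    unfolding filterlim_at_top eventually_strings_at_top by blast
  have "?often (nat Z)"
  proof
    fix N
    obtain s where "N \<le> str_num s" "\<not> Z \<le> int (f s) - int (?c s)"
      using Z by blast
    then show "\<exists>s. N \<le> str_num s \<and> f s \<le> ?c s + nat Z"
      by (intro exI[of _ s]) linarith
  qed
  define L where "L = (LEAST L. ?often L)"
  have often: "?often L"
    unfolding L_def by (rule LeastI) fact
  \<comment> \<open>The lower bound matching \<open>often\<close>. For \<open>L = 0\<close> it is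
    the hypothesis on \<open>f\<close>; for \<open>L = Suc K\<close>, minimality excludes
    \<open>f s \<le> ?c s + K\<close> beyond some \<open>N\<close>.\<close>
  have "\<exists>N. \<forall>s. N \<le> str_num s \<longrightarrow> ?c s + L \<le> f s"
  proof (cases L)
    case 0
    then show ?thesis using assms(2) by auto
  next
    case (Suc K)
    then have "\<not> ?often K"
      using not_less_Least[of K ?often] by (simp add: L_def)
    then show ?thesis
      using Suc by (metis add_Suc_right not_less_eq_eq)
  qed
  then obtain N where N: "\<And>s. N \<le> str_num s \<Longrightarrow> ?c s + L \<le> f s"
    by blast

  \<comment> \<open>A recursive test that all programs have been found\<close>
  obtain v where v: "\<And>p s. V p = Some s \<longleftrightarrow> computes v [str_num p] (str_num s)"
    using assms(1)
    unfolding optimal_prefix_free_machine_def prefix_free_machine_def partial_recursive_def by blast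
  obtain h where h: "\<And>s n. f s \<le> n \<longleftrightarrow> (\<exists>y. computes h [str_num s, n] y)"
    using assms(3) unfolding right_computable_def rec_enumerable_def by auto

  text \<open>\<open>cnt s t x\<close> counts the programs of \<open>s\<close> found within fuel \<open>t\<close> among those numbered at least
    \<open>x * x\<close>.  If \<open>f s \<le> L + cnt s t x\<close> then, by the choice of \<open>L\<close>, all programs of \<open>s\<close> have been
    counted, so all of them are long.\<close>

  define cnt :: "nat \<Rightarrow> nat \<Rightarrow> nat \<Rightarrow> nat" where
    "cnt s t x = (\<Sum>q<t. of_bool (x * x \<le> q) * of_bool (ev v t [q] = Suc s))" for s t x
  \<comment> \<open>A product of three tests: \<open>x\<close> is the number of some input
    \<open>0^k 1\<close>, \<open>s\<close> lies where the lower bound on \<open>f\<close> holds, and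
    \<open>f s \<le> L + cnt s t x\<close> has been verified. \<open>L\<close> and \<open>N\<close>
    are built in as constants. With \<open>x = 2 ^ Suc k\<close>, the threshold \<open>x * x\<close>
    doubles the exponent.\<close>
  define P where "P s t x = (\<Sum>k<x. of_bool (x = 2 ^ Suc k)) * of_bool (N \<le> s) * ev h t [s, L + cnt s t x]"
    for s t x :: nat
  have cnt_card: "cnt s t x = card {q. q < t \<and> x * x \<le> q \<and> ev v t [q] = Suc s}" for s t x
  proof -
    have "cnt s t x = (\<Sum>q<t. if x * x \<le> q \<and> ev v t [q] = Suc s then 1 else 0)"
      unfolding cnt_def by (rule sum.cong) auto
    also have "\<dots> = card ({..<t} \<inter> {q. x * x \<le> q \<and> ev v t [q] = Suc s})"
      by (subst sum.If_cases) (auto simp: Int_def)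
    finally show ?thesis by (simp add: Int_def)
  qed

  \<comment> \<open>Soundness and completeness of the test\<close>
  have inj: "inj str_num" and surj: "surj str_num"
    using bij_str_num by (auto simp: bij_def)
  have card_num: "card (str_num ` programs V s) = ?c s" for s
    using inj by (intro card_image) (auto intro: inj_on_subset)
  have found: "{q. q < t \<and> x * x \<le> q \<and> ev v t [q] = Suc (str_num s)} \<subseteq> str_num ` programs V s"
    for s t x
  proof
    fix q assume "q \<in> {q. q < t \<and> x * x \<le> q \<and> ev v t [q] = Suc (str_num s)}"
    then have "computes v [q] (str_num s)" by (auto intro: ev_sound)
    moreover obtain p where "q = str_num p" using surj by (meson surjD)
    ultimately show "q \<in> str_num ` programs V s" using v by (auto simp: programs_def)
  qed
  have sound: "x * x \<le> str_num q" if "P (str_num s) t x \<noteq> 0" "V q = Some s" for s t x q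
  proof -
    have "N \<le> str_num s" "ev h t [str_num s, L + cnt (str_num s) t x] \<noteq> 0"
      using that(1) by (auto simp: P_def)
    moreover from this(2) have "f s \<le> L + cnt (str_num s) t x"
      using h ev_sound not0_implies_Suc by metis
    ultimately have "?c s \<le> cnt (str_num s) t x"
      using N[of s] by linarith
    \<comment> \<open>The programs counted form a subset of the finite set of all programs of
      \<open>s\<close> with at least as many elements, hence the whole set.\<close>
    then have "{q. q < t \<and> x * x \<le> q \<and> ev v t [q] = Suc (str_num s)} = str_num ` programs V s"
      using found assms(2) by (intro card_seteq) (auto simp: cnt_card card_num)
    moreover have "str_num q \<in> str_num ` programs V s"
      using that(2) by (auto simp: programs_def)
    ultimately show ?thesis by blast
  qed
  have complete: "\<exists>s. eventually (\<lambda>t. P s t (2 ^ Suc k) \<noteq> 0) sequentially" for k :: nat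
  proof -
    define x :: nat where "x = 2 ^ Suc k"
    have "finite {q. str_num q < x * x}"
      using finite_vimageI[OF finite_lessThan inj] by (simp add: vimage_def)
    \<comment> \<open>Only finitely many strings are outputs of programs below \<open>x * x\<close>.
      Where \<open>V q\<close> is undefined, \<open>the (V q)\<close> merely adds an unspecified
      string to this finite set.\<close>
    then have "finite ((\<lambda>q. str_num (the (V q))) ` {q. str_num q < x * x})"
      by simp
    then obtain B where B: "\<And>q. str_num q < x * x \<Longrightarrow> str_num (the (V q)) < B"
      using finite_nat_set_iff_bounded by auto
    obtain s where s: "max N B \<le> str_num s" "f s \<le> ?c s + L"
      using often by blast
    have large: "x * x \<le> str_num q" if "q \<in> programs V s" for q
    proof (rule ccontr)
      assume "\<not> ?thesis"
      with B[of q] that s(1) show False by (auto simp: programs_def)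
    qed
    obtain y where y: "computes h [str_num s, L + ?c s] y"
      using h s(2) by (metis add.commute)
    \<comment> \<open>With enough fuel every program of \<open>s\<close> is found, so the count
      settles at \<open>?c s\<close>. From then on \<open>h\<close> is run on the fixed input
      \<open>L + ?c s\<close>, on which it halts.\<close>
    have "eventually (\<lambda>t. \<forall>q\<in>programs V s. ev v t [str_num q] = Suc (str_num s) \<and> str_num q < t) sequentially"
    proof (rule eventually_ball_finite)
      show "finite (programs V s)" using assms(2) by blast
      show "\<forall>q\<in>programs V s. eventually (\<lambda>t. ev v t [str_num q] = Suc (str_num s) \<and> str_num q < t) sequentially"
        using v by (auto simp: programs_def intro!: eventually_conj ev_complete eventually_gt_at_top)
    qed
    with ev_complete[OF y] have "eventually (\<lambda>t. P (str_num s) t x \<noteq> 0) sequentially"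
    proof eventually_elim
      case (elim t)
      have "str_num ` programs V s \<subseteq> {q. q < t \<and> x * x \<le> q \<and> ev v t [q] = Suc (str_num s)}"
        using elim(2) large by auto
      then have "{q. q < t \<and> x * x \<le> q \<and> ev v t [q] = Suc (str_num s)} = str_num ` programs V s"
        using found by (intro subset_antisym)
      then have "cnt (str_num s) t x = ?c s"
        by (simp only: cnt_card card_num)
      moreover have "k < x"
        unfolding x_def using less_exp[of "Suc k"] by linarith
      then have "(\<Sum>k<x. of_bool (x = 2 ^ Suc k)) \<noteq> (0::nat)"
        unfolding x_def by auto
      ultimately show ?case
        using elim(1) s(1) by (auto simp: P_def)
    qed
    then show ?thesis unfolding x_def by blast
  qed

  \<comment> \<open>Recursiveness of the test and the machine \<open>C\<close>\<close>
  have cnt_rec: "rec_fn 3 (\<lambda>ys. cnt (ys ! 0) (ys ! 1) (ys ! 2))"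
  proof -
    have tl: "rec_fn 4 (\<lambda>ys. tl ys ! i)" if "i < 3" for i
      using that by (intro rec_fn_cong[OF rec_fn_nth[of "Suc i" 4]]) (auto simp: nth_tl)
    have "rec_fn (Suc 3) (\<lambda>ys. of_bool (tl ys ! 2 * tl ys ! 2 \<le> hd ys)
        * of_bool (ev v (tl ys ! 1) [hd ys] = Suc (tl ys ! 0)))"
      by (simp, intro rec_fn_mult rec_fn_le rec_fn_eq rec_fn_Suc tl rec_fn_hd rec_fn_ev_comp[where m = "Suc 0"]
          rec_tuple_Cons rec_tuple_Nil) auto
    then show ?thesis
      unfolding cnt_def
      by (intro rec_fn_sum[where G = "\<lambda>q ys. of_bool (ys ! 2 * ys ! 2 \<le> q)
        * of_bool (ev v (ys ! 1) [q] = Suc (ys ! 0))"] rec_fn_nth) auto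
  qed
  have "rec_fn (Suc 3) (\<lambda>ys. of_bool (tl ys ! 2 = 2 ^ Suc (hd ys)))"
    by (intro rec_fn_eq rec_fn_power rec_fn_Suc rec_fn_hd rec_fn_comp[OF rec_fn_nth rec_tuple_tl]) auto
  then have "rec_fn 3 (\<lambda>ys. P (ys ! 0) (ys ! 1) (ys ! 2))"
    unfolding P_def
    by (intro rec_fn_mult rec_fn_le rec_fn_const rec_fn_nth rec_fn_add cnt_rec rec_fn_ev_comp[where m = "Suc (Suc 0)"]
        rec_tuple_Cons rec_tuple_Nil rec_fn_sum[where G = "\<lambda>k ys. of_bool (ys ! 2 = 2 ^ Suc k)"]) auto
  then obtain r where r: "\<And>x s. computes r [x] s \<Longrightarrow> \<exists>t. P s t x \<noteq> 0"
    and r_ex: "\<And>x s. eventually (\<lambda>t. P s t x \<noteq> 0) sequentially \<Longrightarrow> \<exists>s. computes r [x] s"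
    by (rule ex_recf_choice) blast
  define C where "C p = (if \<exists>s. computes r [str_num p] (str_num s)
    then Some (SOME s. computes r [str_num p] (str_num s)) else None)" for p
  have C: "C p = Some s \<longleftrightarrow> computes r [str_num p] (str_num s)" for p s
  proof
    assume "C p = Some s"
    then show "computes r [str_num p] (str_num s)"
      unfolding C_def by (metis option.distinct(1) option.inject someI_ex)
  next
    assume s: "computes r [str_num p] (str_num s)"
    then have "computes r [str_num p] (str_num (SOME s. computes r [str_num p] (str_num s)))"
      by (rule someI)
    \<comment> \<open>Determinism and injectivity of \<open>str_num\<close> leave a single candidate
      for the choice.\<close>
    then have "(SOME s. computes r [str_num p] (str_num s)) = s"
      using s computes_deterministic inj by (metis injD)
    then show "C p = Some s"
      using s unfolding C_def by auto
  qed
  have "dom C \<subseteq> range (\<lambda>k. replicate k False @ [True])"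
  proof
    fix p assume "p \<in> dom C"
    then obtain s where "computes r [str_num p] (str_num s)"
      using C by blast
    then obtain t where "P (str_num s) t (str_num p) \<noteq> 0"
      using r by blast
    then obtain k where "str_num p = 2 ^ Suc k"
      by (auto simp: P_def split: if_splits)
    then have "p = replicate k False @ [True]"
      using inj str_num_unary by (metis injD)
    then show "p \<in> range (\<lambda>k. replicate k False @ [True])" by blast
  qed
  then have "prefix_free (dom C)"
    using prefix_free_unary unfolding prefix_free_def by blast
  then have "prefix_free_machine C"
    unfolding prefix_free_machine_def partial_recursive_def using C by blast

  \<comment> \<open>Contradiction with optimality\<close>
  then obtain d where d: "\<And>p. p \<in> dom C \<Longrightarrow> \<exists>q. V q = C p \<and> length q \<le> length p + d"
    using assms(1) unfolding optimal_prefix_free_machine_def by blast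
  \<comment> \<open>Taking \<open>k = d\<close> makes the bounds collide: optimality gives a program
    of length at most \<open>2 * d + 1\<close>, while \<open>sound\<close> puts its number at or
    above \<open>2 ^ (2 * d + 2)\<close>, so its length is at least
    \<open>2 * d + 2\<close>.\<close>
  define p where "p = replicate d False @ [True]"
  have p: "str_num p = 2 ^ Suc d"
    unfolding p_def by (rule str_num_unary)
  obtain s where s: "computes r [str_num p] (str_num s)"
    using complete[of d] r_ex surj p by (metis surjD)
  then have Cp: "C p = Some s" by (simp add: C)
  then obtain q where q: "V q = Some s" "length q \<le> length p + d"
    using d by fastforce
  obtain t where "P (str_num s) t (str_num p) \<noteq> 0"
    using r s by blast
  then have "str_num p * str_num p \<le> str_num q"
    using q(1) by (rule sound)
  then have "2 ^ (Suc d + Suc d) < (2::nat) ^ Suc (length q)"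
    using str_num_less[of q] unfolding p power_add by linarith
  then have "Suc d + Suc d < Suc (length q)"
    by (rule power_less_imp_less_exp[rotated]) simp
  then show False
    using q(2) by (simp add: p_def)
qed

end
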